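(* There is a polynomial-time algorithm that, given a $P_5$-free chordal bipartite graph $G$, decides whether $G$ has a Hamiltonian cycle and outputs one if it exists; likewise there is a polynomial-time algorithm that decides whether $G$ has a Hamiltonian path and outputs one if it exists.
   Context: Graphs are finite, simple, undirected and connected. A bipartite graph is chordal bipartite if every cycle of length at least six has a chord. $P_5$-free means no induced path on five vertices. *)

theory Defs
  imports Main
begin

section \<open>Graphs\<close>

record 'a ugraph =
  vertices :: "'a set"
  edges :: "'a set set"

definition simple_graph :: "'a ugraph \<Rightarrow> bool" where
  "simple_graph G \<longleftrightarrow> finite (vertices G) \<and> (\<forall>e\<in>edges G. e \<subseteq> vertices G \<and> card e = 2)"

definition path_edges :: "'a list \<Rightarrow> 'a set set" where
  "path_edges xs = {{xs ! i, xs ! Suc i} | i. Suc i < length xs}"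

definition cycle_edges :: "'a list \<Rightarrow> 'a set set" where
  "cycle_edges xs = insert {last xs, hd xs} (path_edges xs)"

text \<open>A path or cycle is given by the list of its vertices; for a cycle the closing edge
  is implicit, so the length of a cycle is the length of the list.\<close>

definition is_path :: "'a ugraph \<Rightarrow> 'a list \<Rightarrow> bool" where
  "is_path G xs \<longleftrightarrow> xs \<noteq> [] \<and> distinct xs \<and> set xs \<subseteq> vertices G \<and> path_edges xs \<subseteq> edges G"

definition is_cycle :: "'a ugraph \<Rightarrow> 'a list \<Rightarrow> bool" where
  "is_cycle G xs \<longleftrightarrow>
     3 \<le> length xs \<and> distinct xs \<and> set xs \<subseteq> vertices G \<and> cycle_edges xs \<subseteq> edges G"

definition connected_graph :: "'a ugraph \<Rightarrow> bool" where
  "connected_graph G \<longleftrightarrow> vertices G \<noteq> {} \<and>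
     (\<forall>u\<in>vertices G. \<forall>v\<in>vertices G. \<exists>xs. is_path G xs \<and> hd xs = u \<and> last xs = v)"

definition bipartite :: "'a ugraph \<Rightarrow> bool" where
  "bipartite G \<longleftrightarrow> (\<exists>A B. A \<union> B = vertices G \<and> A \<inter> B = {} \<and>
     (\<forall>e\<in>edges G. \<exists>a\<in>A. \<exists>b\<in>B. e = {a, b}))"

definition has_chord :: "'a ugraph \<Rightarrow> 'a list \<Rightarrow> bool" where
  "has_chord G xs \<longleftrightarrow> (\<exists>e\<in>edges G. e \<subseteq> set xs \<and> e \<notin> cycle_edges xs)"

definition chordal_bipartite :: "'a ugraph \<Rightarrow> bool" where
  "chordal_bipartite G \<longleftrightarrow> bipartite G \<and>
     (\<forall>xs. is_cycle G xs \<and> 6 \<le> length xs \<longrightarrow> has_chord G xs)"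

definition is_induced_path :: "'a ugraph \<Rightarrow> 'a list \<Rightarrow> bool" where
  "is_induced_path G xs \<longleftrightarrow> is_path G xs \<and> {e \<in> edges G. e \<subseteq> set xs} = path_edges xs"

definition P5_free :: "'a ugraph \<Rightarrow> bool" where
  "P5_free G \<longleftrightarrow> \<not> (\<exists>xs. is_induced_path G xs \<and> length xs = 5)"

definition hamiltonian_path :: "'a ugraph \<Rightarrow> 'a list \<Rightarrow> bool" where
  "hamiltonian_path G xs \<longleftrightarrow> is_path G xs \<and> set xs = vertices G"

definition hamiltonian_cycle :: "'a ugraph \<Rightarrow> 'a list \<Rightarrow> bool" where
  "hamiltonian_cycle G xs \<longleftrightarrow> is_cycle G xs \<and> set xs = vertices G"


section \<open>Random access machine programs and their running time\<close>

text \<open>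
  The machine model is the unit-cost random access machine whose only arithmetic is addition
  and truncated subtraction, programmed with structured control flow. The memory is a family
  of arrays of natural numbers indexed by names; a scalar variable \<open>x\<close> is cell \<open>0\<close> of array
  \<open>x\<close>. A program mentions only finitely many arrays.

  A fixed program can lengthen the binary representation of the largest number in use by only
  a constant number of bits per step (there is no multiplication), so polynomial time here
  coincides with polynomial time on Turing machines. Each assignment and each test counts as
  one step; the expressions in it have a size that is fixed by the program, independently of
  the input.
\<close>

type_synonym store = "string \<Rightarrow> nat \<Rightarrow> nat"

datatype aexp = Const nat | Read string aexp | Add aexp aexp | Sub aexp aexp

datatype bexp = Less aexp aexp | Equal aexp aexp | Negate bexp | Conj bexp bexp

datatype com =
    Skip
  | Write string aexp aexp
  | Seq com com
  | Cond bexp com com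
  | While bexp com

primrec aval :: "aexp \<Rightarrow> store \<Rightarrow> nat" where
  "aval (Const k) s = k"
| "aval (Read x e) s = s x (aval e s)"
| "aval (Add e f) s = aval e s + aval f s"
| "aval (Sub e f) s = aval e s - aval f s"

primrec bval :: "bexp \<Rightarrow> store \<Rightarrow> bool" where
  "bval (Less e f) s \<longleftrightarrow> aval e s < aval f s"
| "bval (Equal e f) s \<longleftrightarrow> aval e s = aval f s"
| "bval (Negate b) s \<longleftrightarrow> \<not> bval b s"
| "bval (Conj b c) s \<longleftrightarrow> bval b s \<and> bval c s"

text \<open>\<open>exec c s t s'\<close>: started in store \<open>s\<close>, program \<open>c\<close> halts after \<open>t\<close> steps in store \<open>s'\<close>.
  If \<open>c\<close> diverges on \<open>s\<close>, no such \<open>t\<close> and \<open>s'\<close> exist.\<close>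

inductive exec :: "com \<Rightarrow> store \<Rightarrow> nat \<Rightarrow> store \<Rightarrow> bool" where
  Skip: "exec Skip s 1 s"
| Write: "exec (Write x e f) s 1 (s(x := (s x)(aval e s := aval f s)))"
| Seq: "exec c s t s' \<Longrightarrow> exec d s' u s'' \<Longrightarrow> exec (Seq c d) s (t + u) s''"
| CondTrue: "bval b s \<Longrightarrow> exec c s t s' \<Longrightarrow> exec (Cond b c d) s (Suc t) s'"
| CondFalse: "\<not> bval b s \<Longrightarrow> exec d s t s' \<Longrightarrow> exec (Cond b c d) s (Suc t) s'"
| WhileFalse: "\<not> bval b s \<Longrightarrow> exec (While b c) s 1 s"
| WhileTrue: "bval b s \<Longrightarrow> exec c s t s' \<Longrightarrow> exec (While b c) s' u s'' \<Longrightarrow>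
    exec (While b c) s (Suc (t + u)) s''"

lemma exec_deterministic:
  "exec c s t s' \<Longrightarrow> exec c s u s'' \<Longrightarrow> t = u \<and> s' = s''"
proof (induction arbitrary: u s'' rule: exec.induct)
  case Skip
  then show ?case by (auto elim: exec.cases)
next
  case Write
  then show ?case by (auto elim: exec.cases)
next
  case (Seq c s t s' d v r)
  from Seq.prems show ?case by cases (use Seq.IH in blast)
next
  case (CondTrue b s c t s' d)
  from CondTrue.prems show ?case by cases (use CondTrue in blast)+
next
  case (CondFalse b s d t s' c)
  from CondFalse.prems show ?case by cases (use CondFalse in blast)+
next
  case (WhileFalse b s c)
  from WhileFalse.prems show ?case by cases (use WhileFalse in auto)
next
  case (WhileTrue b s c t s' v r)
  from WhileTrue.prems show ?case by cases (use WhileTrue in blast)+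
qed


section \<open>Polynomial-time search problems on graphs\<close>

text \<open>A graph on the vertices \<open>0, \<dots>, n - 1\<close> is input as the number \<open>n\<close> together with its
  adjacency matrix, stored row by row; all other memory cells are zero.\<close>

definition graph_input :: "nat ugraph \<Rightarrow> store" where
  "graph_input G = (let n = card (vertices G) in (\<lambda>x i.
     if x = ''n'' \<and> i = 0 then n
     else if x = ''adj'' \<and> i < n * n \<and> {i div n, i mod n} \<in> edges G then 1
     else 0))"

definition list_output :: "store \<Rightarrow> nat list" where
  "list_output s = map (s ''out'') [0..<s ''out_length'' 0]"

text \<open>One program has to answer correctly on every graph of the given class within a number
  of steps polynomial in the number of vertices (equivalently, in the size of the adjacency
  matrix): the cell \<open>answer\<close> says whether a solution exists, and if so the output list is one.
  Nothing is required on inputs outside the class.\<close>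

definition poly_time_search ::
    "(nat ugraph \<Rightarrow> bool) \<Rightarrow> (nat ugraph \<Rightarrow> nat list \<Rightarrow> bool) \<Rightarrow> bool" where
  "poly_time_search Inst Sol \<longleftrightarrow> (\<exists>c a k. \<forall>G n.
     simple_graph G \<and> vertices G = {..<n} \<and> Inst G \<longrightarrow>
     (\<exists>t s. exec c (graph_input G) t s \<and> t \<le> a * n ^ k + a \<and>
       (if \<exists>xs. Sol G xs
        then s ''answer'' 0 = 1 \<and> Sol G (list_output s)
        else s ''answer'' 0 = 0)))"

end

theory Submission
  imports Defs
begin

text \<open>
  A connected \<open>P\<^sub>5\<close>-free bipartite graph is a chain graph: having a common neighbour is transitive
  on a colour class (else there is an induced \<open>P\<^sub>5\<close>), so by connectivity any two vertices of a class
  have a common neighbour, and then incomparable neighbourhoods would again give an induced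
  \<open>P\<^sub>5\<close>.

  Let \<open>X\<close> be the larger class, with vertices \<open>x\<^sub>0, x\<^sub>1, \<dots>\<close> of increasing degree, and let
  \<open>y\<^sub>0, y\<^sub>1, \<dots>\<close> be the other class, of decreasing degree. If any Hamiltonian path exists, then
  \<open>x\<^sub>0, y\<^sub>0, x\<^sub>1, y\<^sub>1, \<dots>\<close> is one, and if any Hamiltonian cycle exists, then
  \<open>y\<^sub>0, x\<^sub>0, y\<^sub>1, x\<^sub>1, \<dots>\<close> is one: a set of \<open>k\<close> vertices of \<open>X\<close> has at least \<open>k\<close>
  neighbours on the given path, if \<open>k\<close> is at most the size of the other class, and at least \<open>k + 1\<close>
  on the given cycle, if \<open>0 < k < |X|\<close>. This bounds the degrees from below.
  So the algorithm only has to build this one list and check its adjacencies. Sorting amounts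
  to counting predecessors, hence every array involved has the form
  \<open>y[v] = \<Sum>{e(v, w) | w < n, b(v, w)}\<close> in terms of earlier ones.
\<close>

section \<open>Programs made of double loops\<close>

abbreviation Var :: "string \<Rightarrow> aexp" where
  "Var x \<equiv> Read x (Const 0)"

abbreviation set_var :: "store \<Rightarrow> string \<Rightarrow> nat \<Rightarrow> store" where
  "set_var s x k \<equiv> s(x := (s x)(0 := k))"

section \<open>Counting loops and their cost\<close>

definition for_loop :: "string \<Rightarrow> com \<Rightarrow> com" where
  "for_loop x c = Seq (Write x (Const 0) (Const 0))
     (While (Less (Var x) (Var ''n'')) (Seq c (Write x (Const 0) (Add (Var x) (Const 1)))))"

text \<open>Induction on the number of remaining rounds. A round costs \<open>T\<close> for the body
  plus one step each for test and increment; the final failing test accounts for the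
  \<open>+ 1\<close>. The body must preserve the counter, because the increment reads it.\<close>

lemma exec_while_count:
  assumes step: "\<And>i s. i < n \<Longrightarrow> I i s \<Longrightarrow> s x 0 = i \<and> s ''n'' 0 = n \<and>
      (\<exists>t s'. exec c s t s' \<and> t \<le> T \<and> s' x 0 = i \<and> I (Suc i) (set_var s' x (Suc i)))"
    and stop: "\<And>s. I n s \<Longrightarrow> s x 0 = n \<and> s ''n'' 0 = n"
    and start: "I i s" "i \<le> n"
  shows "\<exists>t s'. exec (While (Less (Var x) (Var ''n''))
      (Seq c (Write x (Const 0) (Add (Var x) (Const 1))))) s t s' \<and> t \<le> (n - i) * (T + 2) + 1 \<and> I n s'"
  using start
proof (induction "n - i" arbitrary: i s)
  case 0
  then have "i = n" by simp
  with 0 stop[of s] have "\<not> bval (Less (Var x) (Var ''n'')) s" by simp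
  then have "exec (While (Less (Var x) (Var ''n''))
      (Seq c (Write x (Const 0) (Add (Var x) (Const 1))))) s 1 s"
    by (rule exec.WhileFalse)
  then show ?case using 0 \<open>i = n\<close> by auto
next
  case (Suc m)
  let ?c = "Seq c (Write x (Const 0) (Add (Var x) (Const 1)))"
  let ?b = "Less (Var x) (Var ''n'')"
  have "i < n" using Suc by simp
  from step[OF this Suc.prems(1)] obtain t s' where s: "s x 0 = i" "s ''n'' 0 = n"
    and t: "exec c s t s'" "t \<le> T" "s' x 0 = i" "I (Suc i) (set_var s' x (Suc i))"
    by blast
  have "exec (Write x (Const 0) (Add (Var x) (Const 1))) s' 1 (set_var s' x (Suc i))"
    using exec.Write[of x "Const 0" "Add (Var x) (Const 1)" s'] t(3) by simp
  with t(1) have body: "exec ?c s (t + 1) (set_var s' x (Suc i))"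
    by (rule exec.Seq)
  have "m = n - Suc i" using Suc by simp
  from Suc.hyps(1)[OF this t(4)] \<open>i < n\<close> obtain u s'' where u:
    "exec (While ?b ?c) (set_var s' x (Suc i)) u s''" "u \<le> (n - Suc i) * (T + 2) + 1" "I n s''"
    by auto
  have "bval ?b s" using s \<open>i < n\<close> by simp
  from exec.WhileTrue[OF this body u(1)] have "exec (While ?b ?c) s (Suc (t + 1 + u)) s''" .
  moreover have "Suc (t + 1 + u) \<le> (n - i) * (T + 2) + 1"
  proof -
    have "n - i = Suc (n - Suc i)" using \<open>i < n\<close> by simp
    then show ?thesis using u(2) t(2) by simp
  qed
  ultimately show ?case using u(3) by blast
qed

lemma exec_for_loop:
  assumes "\<And>i s. i < n \<Longrightarrow> I i s \<Longrightarrow> s x 0 = i \<and> s ''n'' 0 = n \<and>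
      (\<exists>t s'. exec c s t s' \<and> t \<le> T \<and> s' x 0 = i \<and> I (Suc i) (set_var s' x (Suc i)))"
    and "\<And>s. I n s \<Longrightarrow> s x 0 = n \<and> s ''n'' 0 = n"
    and "I 0 (set_var s x 0)"
  shows "\<exists>t s'. exec (for_loop x c) s t s' \<and> t \<le> n * (T + 2) + 2 \<and> I n s'"
proof -
  have "exec (Write x (Const 0) (Const 0)) s 1 (set_var s x 0)"
    using exec.Write[of x "Const 0" "Const 0" s] by simp
  moreover have "\<exists>t s'. exec (While (Less (Var x) (Var ''n''))
      (Seq c (Write x (Const 0) (Add (Var x) (Const 1))))) (set_var s x 0) t s' \<and>
      t \<le> (n - 0) * (T + 2) + 1 \<and> I n s'"
    by (rule exec_while_count[where I = I, OF _ _ assms(3) le0]) (blast intro!: assms(1,2))+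
  then obtain t s' where
    "exec (While (Less (Var x) (Var ''n''))
      (Seq c (Write x (Const 0) (Add (Var x) (Const 1))))) (set_var s x 0) t s'"
    "t \<le> n * (T + 2) + 1" "I n s'"
    by auto
  ultimately show ?thesis unfolding for_loop_def using exec.Seq by fastforce
qed

section \<open>Double loops and the sums they compute\<close>

primrec areads :: "aexp \<Rightarrow> string set" where
  "areads (Const k) = {}"
| "areads (Read x e) = insert x (areads e)"
| "areads (Add e f) = areads e \<union> areads f"
| "areads (Sub e f) = areads e \<union> areads f"

primrec breads :: "bexp \<Rightarrow> string set" where
  "breads (Less e f) = areads e \<union> areads f"
| "breads (Equal e f) = areads e \<union> areads f"
| "breads (Negate b) = breads b"
| "breads (Conj b c) = breads b \<union> breads c"

lemma aval_cong: "(\<And>x. x \<in> areads e \<Longrightarrow> s x = s' x) \<Longrightarrow> aval e s = aval e s'"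
  by (induction e) auto

lemma bval_cong: "(\<And>x. x \<in> breads b \<Longrightarrow> s x = s' x) \<Longrightarrow> bval b s = bval b s'"
proof (induction b)
  case (Less e f)
  then show ?case using aval_cong[of e s s'] aval_cong[of f s s'] by simp
next
  case (Equal e f)
  then show ?case using aval_cong[of e s s'] aval_cong[of f s s'] by simp
qed auto

abbreviation single :: "nat \<Rightarrow> nat \<Rightarrow> nat" where
  "single k \<equiv> (\<lambda>_. 0)(0 := k)"

abbreviation at_pair :: "store \<Rightarrow> nat \<Rightarrow> nat \<Rightarrow> store" where
  "at_pair s i j \<equiv> s(''v'' := single i, ''w'' := single j)"

text \<open>The closed form of the inner loop. Since \<open>at_pair\<close> overwrites both
  counters, the value does not depend on what they hold in \<open>s\<close>.\<close>

definition tally :: "bexp \<Rightarrow> aexp \<Rightarrow> store \<Rightarrow> nat \<Rightarrow> nat \<Rightarrow> nat" where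
  "tally b e s i j = (\<Sum>k | k < j \<and> bval b (at_pair s i k). aval e (at_pair s i k))"

lemma tally_Suc:
  "tally b e s i (Suc j) = tally b e s i j +
     (if bval b (at_pair s i j) then aval e (at_pair s i j) else 0)"
proof (cases "bval b (at_pair s i j)")
  case True
  have "{k. k < Suc j \<and> bval b (at_pair s i k)} = insert j {k. k < j \<and> bval b (at_pair s i k)}"
    using True by (auto simp: less_Suc_eq)
  then show ?thesis using True by (simp add: tally_def)
next
  case False
  have "{k. k < Suc j \<and> bval b (at_pair s i k)} = {k. k < j \<and> bval b (at_pair s i k)}"
    using False by (auto simp: less_Suc_eq)
  then show ?thesis using False by (simp add: tally_def)
qed

text \<open>This transfers a sum between stores that differ only in the counters and in arrays that
  \<open>b\<close> and \<open>e\<close> do not read.\<close>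

lemma tally_cong:
  assumes "\<And>x. x \<in> breads b \<union> areads e \<Longrightarrow> x \<noteq> ''v'' \<Longrightarrow> x \<noteq> ''w'' \<Longrightarrow> s x = s' x"
  shows "tally b e s i j = tally b e s' i j"
proof -
  have b: "bval b (at_pair s i k) = bval b (at_pair s' i k)" for k
    by (rule bval_cong) (use assms in auto)
  have e: "aval e (at_pair s i k) = aval e (at_pair s' i k)" for k
    by (rule aval_cong) (use assms in auto)
  show ?thesis by (simp add: tally_def b e)
qed

definition accumulate :: "string \<Rightarrow> bexp \<Rightarrow> aexp \<Rightarrow> com" where
  "accumulate y b e = for_loop ''v'' (for_loop ''w''
     (Cond b (Write y (Var ''v'') (Add (Read y (Var ''v'')) e)) Skip))"

text \<open>As \<open>b\<close> and \<open>e\<close> do not read \<open>y\<close>, writing to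
  \<open>y\<close> does not disturb the sum, which can be evaluated in the initial store
  throughout.\<close>

lemma exec_accumulate_row:
  assumes y: "y \<notin> {''v'', ''w'', ''n''}" "y \<notin> breads b \<union> areads e"
    and s: "s ''n'' 0 = n" "s ''v'' = single i" "s ''w'' = single k" "s y i = 0"
  shows "\<exists>t s'. exec (for_loop ''w'' (Cond b (Write y (Var ''v'') (Add (Read y (Var ''v'')) e)) Skip)) s t s'
    \<and> t \<le> n * 4 + 2 \<and> s' = (at_pair s i n)(y := (s y)(i := tally b e s i n))"
proof -
  have y': "''v'' \<noteq> y" "''w'' \<noteq> y" "''n'' \<noteq> y" using y(1) by auto
  let ?I = "\<lambda>j r. r = (at_pair s i j)(y := (s y)(i := tally b e s i j))"
  let ?c = "Cond b (Write y (Var ''v'') (Add (Read y (Var ''v'')) e)) Skip"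
  have step: "\<exists>t r'. exec ?c r t r' \<and> t \<le> 2 \<and> r' ''w'' 0 = j \<and> ?I (Suc j) (set_var r' ''w'' (Suc j))"
    if r: "?I j r" for j r
  proof -
    have b: "bval b r = bval b (at_pair s i j)"
      by (rule bval_cong) (use y r in auto)
    have e: "aval e r = aval e (at_pair s i j)"
      by (rule aval_cong) (use y r in auto)
    show ?thesis
    proof (cases "bval b r")
      case True
      let ?r = "r(y := (r y)(i := tally b e s i (Suc j)))"
      have "exec (Write y (Var ''v'') (Add (Read y (Var ''v'')) e)) r 1 ?r"
        using exec.Write[of y "Var ''v''" "Add (Read y (Var ''v'')) e" r] True e b y y' r
        by (simp add: tally_Suc)
      from exec.CondTrue[OF True this] have "exec ?c r 2 ?r" by (simp add: numeral_2_eq_2)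
      moreover have "?r ''w'' 0 = j" using r y y' by simp
      moreover have "?I (Suc j) (set_var ?r ''w'' (Suc j))"
        using r y y' by (auto simp: fun_eq_iff)
      ultimately show ?thesis by blast
    next
      case False
      from exec.CondFalse[OF False exec.Skip] have "exec ?c r 2 r" by (simp add: numeral_2_eq_2)
      moreover have "r ''w'' 0 = j" using r y y' by simp
      moreover have "?I (Suc j) (set_var r ''w'' (Suc j))"
        using r y y' False b by (auto simp: fun_eq_iff tally_Suc)
      ultimately show ?thesis by blast
    qed
  qed
  have "\<exists>t s'. exec (for_loop ''w'' ?c) s t s' \<and> t \<le> n * (2 + 2) + 2 \<and> ?I n s'"
  proof (rule exec_for_loop[where I = ?I])
    fix j r assume "j < n" "?I j r"
    then show "r ''w'' 0 = j \<and> r ''n'' 0 = n \<and> (\<exists>t s'. exec ?c r t s' \<and> t \<le> 2 \<and> s' ''w'' 0 = j \<and>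
      ?I (Suc j) (set_var s' ''w'' (Suc j)))"
      using step[of r j] y y' s by simp
  next
    show "?I 0 (set_var s ''w'' 0)"
      using y y' s by (auto simp: fun_eq_iff tally_def)
  qed (use y y' s in auto)
  then show ?thesis by simp
qed

lemma exec_accumulate:
  assumes y: "y \<notin> {''v'', ''w'', ''n''}" "y \<notin> breads b \<union> areads e"
    and s: "s ''n'' 0 = n" "s ''v'' = single i0" "s ''w'' = single j0" "s y = (\<lambda>_. 0)"
  shows "\<exists>t s' i j. exec (accumulate y b e) s t s' \<and> t \<le> n * (n * 4 + 4) + 2 \<and>
    s' = (at_pair s i j)(y := (\<lambda>i. if i < n then tally b e s i n else 0))"
proof -
  have y': "''v'' \<noteq> y" "''w'' \<noteq> y" "''n'' \<noteq> y" using y(1) by auto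
  let ?R = "\<lambda>i j. (at_pair s i j)(y := (\<lambda>k. if k < i then tally b e s k n else 0))"
  \<comment> \<open>The inner counter is \<open>j0\<close> before the first row and \<open>n\<close>
    after each row, so its value is left open.\<close>
  let ?I = "\<lambda>i r. \<exists>j. r = ?R i j"
  let ?c = "for_loop ''w'' (Cond b (Write y (Var ''v'') (Add (Read y (Var ''v'')) e)) Skip)"
  have step: "\<exists>t r'. exec ?c r t r' \<and> t \<le> n * 4 + 2 \<and> r' ''v'' 0 = i \<and> ?I (Suc i) (set_var r' ''v'' (Suc i))"
    if r: "r = ?R i j" for i j r
  proof -
    have "r ''n'' 0 = n" "r ''v'' = single i" "r ''w'' = single j" "r y i = 0"
      using r y y' s by auto
    from exec_accumulate_row[OF y this] obtain t r' where t: "exec ?c r t r'" "t \<le> n * 4 + 2"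
      and r': "r' = (at_pair r i n)(y := (r y)(i := tally b e r i n))" by blast
    have "tally b e r i n = tally b e s i n"
      by (rule tally_cong) (use y r in auto)
    then have "set_var r' ''v'' (Suc i) = ?R (Suc i) n"
      using r' r y y' by (auto simp: fun_eq_iff less_Suc_eq)
    moreover have "r' ''v'' 0 = i" using r' y y' by simp
    ultimately show ?thesis using t by blast
  qed
  have "\<exists>t s'. exec (for_loop ''v'' ?c) s t s' \<and> t \<le> n * (n * 4 + 2 + 2) + 2 \<and> ?I n s'"
  proof (rule exec_for_loop[where I = ?I])
    fix i r assume "i < n" "?I i r"
    then show "r ''v'' 0 = i \<and> r ''n'' 0 = n \<and> (\<exists>t s'. exec ?c r t s' \<and> t \<le> n * 4 + 2 \<and> s' ''v'' 0 = i \<and>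
      ?I (Suc i) (set_var s' ''v'' (Suc i)))"
      using step y y' s by fastforce
  next
    have "set_var s ''v'' 0 = ?R 0 j0"
      using y y' s by (auto simp: fun_eq_iff)
    then show "?I 0 (set_var s ''v'' 0)" by blast
  qed (use y y' s in auto)
  then obtain t j where "exec (for_loop ''v'' ?c) s t (?R n j)" "t \<le> n * (n * 4 + 2 + 2) + 2"
    by blast
  moreover from this(2) have "t \<le> n * (n * 4 + 4) + 2" by (simp add: algebra_simps)
  ultimately show ?thesis unfolding accumulate_def by blast
qed

text \<open>A stage \<open>(y, b, e)\<close> computes one array \<open>y\<close>, which starts out zero, by the double loop above.\<close>

type_synonym stage = "string \<times> bexp \<times> aexp"

primrec program :: "stage list \<Rightarrow> com" where
  "program [] = Skip"
| "program (p # ps) = (case p of (y, b, e) \<Rightarrow> Seq (accumulate y b e) (program ps))"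

text \<open>The first argument is the set of arrays that already hold their final contents.\<close>

primrec well_staged :: "string set \<Rightarrow> stage list \<Rightarrow> bool" where
  "well_staged K [] \<longleftrightarrow> True"
| "well_staged K (p # ps) \<longleftrightarrow> (case p of (y, b, e) \<Rightarrow>
     y \<notin> K \<and> y \<notin> {''v'', ''w''} \<and> breads b \<union> areads e \<subseteq> K \<union> {''v'', ''w''} \<and>
     well_staged (insert y K) ps)"

text \<open>No array is written again after its own stage or after being read, so the defining
  equation of every stage survives to the end. All equations thus hold in the single store
  \<open>s'\<close>, and intermediate stores can be forgotten.\<close>

lemma exec_program:
  assumes "well_staged K ps" "''n'' \<in> K" "s ''n'' 0 = n" "s ''v'' = single i" "s ''w'' = single j"
    and "\<And>x. x \<notin> K \<Longrightarrow> x \<noteq> ''v'' \<Longrightarrow> x \<noteq> ''w'' \<Longrightarrow> s x = (\<lambda>_. 0)"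
    and "''v'' \<notin> K" "''w'' \<notin> K"
  shows "\<exists>t s'. exec (program ps) s t s' \<and> t \<le> length ps * (n * (n * 4 + 4) + 2) + 1 \<and>
    (\<forall>x\<in>K. s' x = s x) \<and> (\<forall>(y, b, e)\<in>set ps. \<forall>v<n. s' y v = tally b e s' v n)"
  using assms
proof (induction ps arbitrary: K s i j)
  case Nil
  then show ?case using exec.Skip by fastforce
next
  case (Cons p ps)
  obtain y b e where p: "p = (y, b, e)" by (cases p)
  have y: "y \<notin> {''v'', ''w'', ''n''}" "y \<notin> breads b \<union> areads e" "y \<notin> K"
    and re: "breads b \<union> areads e \<subseteq> K \<union> {''v'', ''w''}" and ws: "well_staged (insert y K) ps"
    using Cons.prems p by auto
  have sy: "s y = (\<lambda>_. 0)" using Cons.prems(6) y by simp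
  from exec_accumulate[OF y(1,2) Cons.prems(3-5) sy]
  obtain t r i' j' where t: "exec (accumulate y b e) s t r" "t \<le> n * (n * 4 + 4) + 2"
    and r: "r = (at_pair s i' j')(y := (\<lambda>i. if i < n then tally b e s i n else 0))"
    by blast
  have "r x = (\<lambda>_. 0)" if "x \<notin> insert y K" "x \<noteq> ''v''" "x \<noteq> ''w''" for x
    using that Cons.prems(6)[of x] r by simp
  moreover have "r ''n'' 0 = n" "r ''v'' = single i'" "r ''w'' = single j'"
    using r y Cons.prems(3) by auto
  moreover have "''n'' \<in> insert y K" "''v'' \<notin> insert y K" "''w'' \<notin> insert y K"
    using y Cons.prems by auto
  ultimately obtain u s' where u: "exec (program ps) r u s'"
      "u \<le> length ps * (n * (n * 4 + 4) + 2) + 1"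
    and s': "\<forall>x\<in>insert y K. s' x = r x"
      "\<forall>(y, b, e)\<in>set ps. \<forall>v<n. s' y v = tally b e s' v n"
    using Cons.IH[OF ws, of r i' j'] by blast
  have K: "s' x = s x" if "x \<in> K" for x
  proof -
    have "x \<noteq> ''v''" "x \<noteq> ''w''" "x \<noteq> y" using that y Cons.prems by auto
    then show ?thesis using s'(1) that r by simp
  qed
  have "s' y v = tally b e s' v n" if "v < n" for v
  proof -
    have "s' y v = tally b e s v n" using s'(1) r that by simp
    also have "\<dots> = tally b e s' v n"
      by (rule tally_cong) (use K re in auto)
    finally show ?thesis .
  qed
  moreover have "exec (program (p # ps)) s (t + u) s'"
    using exec.Seq[OF t(1) u(1)] p by simp
  moreover have "t + u \<le> length (p # ps) * (n * (n * 4 + 4) + 2) + 1"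
    using t(2) u(2) by simp
  moreover have "\<forall>x\<in>K. s' x = s x" using K by blast
  ultimately show ?case using s'(2) p by (intro exI[of _ "t + u"] exI[of _ s']) auto
qed

section \<open>Hamiltonian paths and cycles in chain graphs\<close>

text \<open>Halving is injective on numbers of equal parity.\<close>

lemma card_same_parity_le:
  fixes I :: "nat set"
  assumes "I \<subseteq> {..<n}" "\<And>i. i \<in> I \<Longrightarrow> even i = p"
  shows "2 * card I \<le> n + 1"
proof -
  have "inj_on (\<lambda>i. i div 2) I"
  proof (rule inj_onI)
    fix i j assume "i \<in> I" "j \<in> I" "i div 2 = j div 2"
    then have "even i = even j" using assms(2) by blast
    with \<open>i div 2 = j div 2\<close> show "i = j" by presburger
  qed
  moreover have "(\<lambda>i. i div 2) ` I \<subseteq> {..<(n + 1) div 2}"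
    using assms(1) by auto
  ultimately have "card I \<le> card {..<(n + 1) div 2}"
    by (metis card_inj_on_le finite_lessThan)
  then show ?thesis by simp
qed

text \<open>Each index moves one step towards \<open>j\<close>. Two indices could collide only at
  \<open>j\<close> itself, which those below \<open>j\<close> miss by parity.\<close>

lemma inj_on_step_away:
  fixes I :: "nat set"
  assumes "\<And>i. i \<in> I \<Longrightarrow> i \<noteq> j \<and> (i < j \<longrightarrow> even i = even j)"
  shows "inj_on (\<lambda>i. if i < j then Suc i else i - 1) I"
proof (rule inj_onI)
  fix a b assume *: "a \<in> I" "b \<in> I"
    "(if a < j then Suc a else a - 1) = (if b < j then Suc b else b - 1)"
  have ab: "a \<noteq> j" "a < j \<Longrightarrow> even a = even j" "b \<noteq> j" "b < j \<Longrightarrow> even b = even j"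
    using assms * by blast+
  have no_straddle: "j \<noteq> Suc x" if "even x = even j" for x
    using that by auto
  show "a = b"
  proof (cases "a < j"; cases "b < j")
    assume "a < j" "\<not> b < j"
    then have "j = Suc a" using *(3) ab(3) by simp
    then show ?thesis using no_straddle ab(2) \<open>a < j\<close> by blast
  next
    assume "\<not> a < j" "b < j"
    then have "j = Suc b" using *(3) ab(1) by simp
    then show ?thesis using no_straddle ab(4) \<open>b < j\<close> by blast
  next
    assume "\<not> a < j" "\<not> b < j"
    then show ?thesis using *(3) ab(1,3) by simp
  qed (use *(3) in simp)
qed

section \<open>Degree order and ranks in a chain graph\<close>

locale bipartite_chain =
  fixes n :: nat and E :: "nat \<Rightarrow> nat \<Rightarrow> bool" and X :: "nat set"
  assumes sym: "E u v \<Longrightarrow> E v u"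
    and dom: "E u v \<Longrightarrow> u < n"
    and sub: "X \<subseteq> {..<n}"
    and cross: "E u v \<Longrightarrow> u \<in> X \<longleftrightarrow> v \<notin> X"
    and nested: "u < n \<Longrightarrow> v < n \<Longrightarrow> u \<in> X \<longleftrightarrow> v \<in> X \<Longrightarrow>
      (\<forall>w. E u w \<longrightarrow> E v w) \<or> (\<forall>w. E v w \<longrightarrow> E u w)"
    and large: "n \<le> 2 * card X"
begin

definition deg :: "nat \<Rightarrow> nat" where
  "deg v = card {w. w < n \<and> E v w}"

text \<open>Degrees increase on \<open>X\<close> and decrease off \<open>X\<close>. Breaking ties by
  vertex number gives a strict total order on each class.\<close>

definition prec :: "nat \<Rightarrow> nat \<Rightarrow> bool" where
  "prec u v \<longleftrightarrow> (if v \<in> X then deg u < deg v else deg v < deg u) \<or> deg u = deg v \<and> u < v"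

definition below :: "nat \<Rightarrow> nat set" where
  "below v = {u. u < n \<and> (u \<in> X \<longleftrightarrow> v \<in> X) \<and> prec u v}"

definition rank :: "nat \<Rightarrow> nat" where
  "rank v = card (below v)"

lemma finite_below [simp]: "finite (below v)"
  by (simp add: below_def)

lemma finite_X: "finite X"
  using sub finite_subset by blast

lemma rank_less_rank:
  assumes "u < n" "u \<in> X \<longleftrightarrow> v \<in> X" "prec u v"
  shows "rank u < rank v"
proof -
  have "prec w v" if "w \<in> below u" for w
    using that assms(2,3) by (cases "v \<in> X") (auto simp: below_def prec_def)
  then have "below u \<subseteq> below v"
    using assms(2) by (auto simp: below_def)
  moreover have "u \<in> below v" "u \<notin> below u"
    using assms by (simp_all add: below_def prec_def)
  ultimately have "below u \<subset> below v" by blast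
  then show ?thesis unfolding rank_def by (simp add: psubset_card_mono)
qed

lemma rank_inj:
  assumes "u < n" "v < n" "u \<in> X \<longleftrightarrow> v \<in> X" "rank u = rank v"
  shows "u = v"
proof (rule ccontr)
  assume "u \<noteq> v"
  then have "prec u v \<or> prec v u" using assms(3) by (auto simp: prec_def)
  then show False using rank_less_rank assms by (metis nat_neq_iff)
qed

lemma rank_less_card:
  assumes "v < n"
  shows "rank v < card {u. u < n \<and> (u \<in> X \<longleftrightarrow> v \<in> X)}"
proof -
  have "below v \<subset> {u. u < n \<and> (u \<in> X \<longleftrightarrow> v \<in> X)}"
    using assms by (auto simp: below_def prec_def)
  then show ?thesis unfolding rank_def by (simp add: psubset_card_mono)
qed

lemma rank_less_in: "v \<in> X \<Longrightarrow> rank v < card X"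
proof -
  assume "v \<in> X"
  moreover from this have "{u. u < n \<and> (u \<in> X \<longleftrightarrow> v \<in> X)} = X" using sub by auto
  ultimately show ?thesis using rank_less_card[of v] sub by auto
qed

lemma card_compl: "card ({..<n} - X) = n - card X"
  using sub by (simp add: card_Diff_subset finite_X)

lemma rank_less_out: "v < n \<Longrightarrow> v \<notin> X \<Longrightarrow> rank v < n - card X"
proof -
  assume "v < n" "v \<notin> X"
  moreover from this have "{u. u < n \<and> (u \<in> X \<longleftrightarrow> v \<in> X)} = {..<n} - X" by auto
  ultimately show ?thesis using rank_less_card[of v] card_compl by auto
qed

text \<open>Otherwise nestedness would make the neighbourhood of \<open>v\<close> a proper subset of
  that of \<open>u\<close>, contradicting the degrees.\<close>

lemma nested_deg:
  assumes "u < n" "v < n" "u \<in> X \<longleftrightarrow> v \<in> X" "deg u \<le> deg v" "E u w"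
  shows "E v w"
proof (rule ccontr)
  assume *: "\<not> E v w"
  then have "\<forall>w. E v w \<longrightarrow> E u w" using nested[OF assms(1-3)] assms(5) by blast
  then have "{w. w < n \<and> E v w} \<subset> {w. w < n \<and> E u w}"
    using * assms(5) dom[OF sym[OF assms(5)]] by blast
  then have "deg v < deg u" unfolding deg_def by (simp add: psubset_card_mono)
  then show False using assms(4) by simp
qed

text \<open>The neighbours of \<open>x\<close> form an initial segment of the other class: if
  \<open>y\<close> is not among them, each has larger degree than \<open>y\<close> and so precedes
  it, whence \<open>deg x \<le> rank y\<close>.\<close>

lemma adjacent_if_rank_less_deg:
  assumes "x \<in> X" "y < n" "y \<notin> X" "rank y < deg x"
  shows "E x y"
proof (rule ccontr)
  assume *: "\<not> E x y"
  have "{w. w < n \<and> E x w} \<subseteq> below y"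
  proof
    fix w assume "w \<in> {w. w < n \<and> E x w}"
    then have w: "w < n" "E x w" by auto
    then have "w \<notin> X" using cross assms by blast
    moreover have "deg y < deg w"
    proof (rule ccontr)
      assume "\<not> deg y < deg w"
      then have "E y x" using nested_deg[of w y x] w assms \<open>w \<notin> X\<close> sym by simp
      then show False using * sym by blast
    qed
    ultimately show "w \<in> below y" using w assms by (simp add: below_def prec_def)
  qed
  then have "deg x \<le> rank y" unfolding deg_def rank_def by (simp add: card_mono)
  then show False using assms by simp
qed

text \<open>All vertices up to \<open>x\<close> in the order have their neighbours among those of
  \<open>x\<close>. A lower bound on the neighbourhood of \<open>S\<close> thereby becomes one on
  \<open>deg x\<close>.\<close>

lemma low_vertices:
  assumes "x \<in> X" "k \<le> Suc (rank x)"
  obtains S where "S \<subseteq> X" "card S = k" "card {w. \<exists>s\<in>S. E s w} \<le> deg x"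
proof -
  let ?S = "insert x (below x)"
  have "x \<notin> below x" by (simp add: below_def prec_def)
  then have "card ?S = Suc (rank x)" by (simp add: rank_def)
  then obtain S where S: "S \<subseteq> ?S" "card S = k"
    using obtain_subset_with_card_n assms(2) by metis
  have "{w. \<exists>s\<in>S. E s w} \<subseteq> {w. w < n \<and> E x w}"
  proof
    fix w assume "w \<in> {w. \<exists>s\<in>S. E s w}"
    then obtain s where s: "s \<in> S" "E s w" by blast
    then have "s = x \<or> s \<in> below x" using S by blast
    then have "E x w"
    proof
      assume "s \<in> below x"
      then show ?thesis using nested_deg[of s x w] s sub assms(1)
        by (auto simp: below_def prec_def)
    qed (use s in simp)
    then show "w \<in> {w. w < n \<and> E x w}" using dom sym by blast
  qed
  then have "card {w. \<exists>s\<in>S. E s w} \<le> deg x" unfolding deg_def by (simp add: card_mono)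
  moreover have "S \<subseteq> X" using S(1) assms(1) by (auto simp: below_def)
  ultimately show ?thesis using that S(2) by blast
qed

section \<open>Neighbourhood bounds from Hamiltonian paths and cycles\<close>

definition ham_path :: "nat list \<Rightarrow> bool" where
  "ham_path xs \<longleftrightarrow> distinct xs \<and> set xs = {..<n} \<and> (\<forall>i. Suc i < length xs \<longrightarrow> E (xs ! i) (xs ! Suc i))"

definition ham_cycle :: "nat list \<Rightarrow> bool" where
  "ham_cycle xs \<longleftrightarrow> ham_path xs \<and> 3 \<le> n \<and> E (xs ! (n - 1)) (xs ! 0)"

context
  fixes xs assumes ham: "ham_path xs"
begin

lemma length_ham: "length xs = n"
  using ham distinct_card[of xs] by (simp add: ham_path_def)

lemma alternating: "i < n \<Longrightarrow> xs ! i \<in> X \<longleftrightarrow> (even i \<longleftrightarrow> xs ! 0 \<in> X)"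
proof (induction i)
  case (Suc i)
  then have "E (xs ! i) (xs ! Suc i)" using ham length_ham by (simp add: ham_path_def)
  from cross[OF this] show ?case using Suc by auto
qed simp

lemma card_indices:
  assumes "S \<subseteq> {..<n}"
  shows "card {i. i < n \<and> xs ! i \<in> S} = card S"
proof -
  have "bij_betw ((!) xs) {i. i < n \<and> xs ! i \<in> S} S"
    unfolding bij_betw_def
  proof
    show "inj_on ((!) xs) {i. i < n \<and> xs ! i \<in> S}"
      using ham length_ham by (auto simp: inj_on_def ham_path_def nth_eq_iff_index_eq)
    show "(!) xs ` {i. i < n \<and> xs ! i \<in> S} = S"
    proof
      show "S \<subseteq> (!) xs ` {i. i < n \<and> xs ! i \<in> S}"
      proof
        fix v assume "v \<in> S"
        then have "v \<in> set xs" using assms ham by (auto simp: ham_path_def)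
        then obtain i where "i < n" "xs ! i = v" using length_ham by (metis in_set_conv_nth)
        then show "v \<in> (!) xs ` {i. i < n \<and> xs ! i \<in> S}" using \<open>v \<in> S\<close> by blast
      qed
    qed auto
  qed
  then show ?thesis by (rule bij_betw_same_card)
qed

lemma card_neighbours_ge:
  assumes "J \<subseteq> {..<n}" "\<And>j. j \<in> J \<Longrightarrow> \<exists>s\<in>S. E s (xs ! j)"
  shows "card J \<le> card {w. \<exists>s\<in>S. E s w}"
proof -
  have "inj_on ((!) xs) J"
    using assms(1) ham length_ham
    by (auto simp: inj_on_def ham_path_def nth_eq_iff_index_eq subset_iff)
  then have "card J = card ((!) xs ` J)" by (simp add: card_image)
  also have "\<dots> \<le> card {w. \<exists>s\<in>S. E s w}"
  proof (rule card_mono)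
    have "{w. \<exists>s\<in>S. E s w} \<subseteq> {..<n}" using dom sym by blast
    then show "finite {w. \<exists>s\<in>S. E s w}" using finite_subset by blast
  qed (use assms(2) in blast)
  finally show ?thesis .
qed

lemma path_step: "Suc i < n \<Longrightarrow> E (xs ! i) (xs ! Suc i)"
  using ham length_ham by (simp add: ham_path_def)

lemma card_X_path: "2 * card X \<le> n + 1"
proof -
  have "2 * card {i. i < n \<and> xs ! i \<in> X} \<le> n + 1"
  proof (rule card_same_parity_le)
    show "even i = (xs ! 0 \<in> X)" if "i \<in> {i. i < n \<and> xs ! i \<in> X}" for i
      using alternating[of i] that by simp
  qed auto
  then show ?thesis using card_indices[OF sub] by simp
qed

text \<open>Every vertex of \<open>S\<close> takes the neighbour on its side of a gap in the path: an end of the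
  path outside \<open>X\<close>, or else a vertex of \<open>X - S\<close>.\<close>

lemma hall_path:
  assumes "S \<subseteq> X" "card S \<le> n - card X"
  shows "card S \<le> card {w. \<exists>s\<in>S. E s w}"
proof -
  define I where "I = {i. i < n \<and> xs ! i \<in> S}"
  have I: "i < n" "xs ! i \<in> S" "even i \<longleftrightarrow> xs ! 0 \<in> X" if "i \<in> I" for i
    using that alternating[of i] assms(1) by (auto simp: I_def)
  \<comment> \<open>The gap \<open>j\<close> is 0 if the path starts outside \<open>X\<close>,
    \<open>n\<close> (just past the end) if it starts in \<open>X\<close> and ends outside, and
    otherwise the position of a vertex of \<open>X - S\<close>. Indices of \<open>S\<close> then
    step towards \<open>j\<close>.\<close>
  have "\<exists>j. \<forall>i\<in>I. i \<noteq> j \<and> (i < j \<longrightarrow> even i = even j \<and> Suc i < n)"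
  proof (cases "xs ! 0 \<in> X")
    case False
    then show ?thesis using I by (metis even_zero not_less_zero)
  next
    case True
    show ?thesis
    proof (cases "even n")
      case even: True
      have "\<forall>i\<in>I. i \<noteq> n \<and> (i < n \<longrightarrow> even i = even n \<and> Suc i < n)"
        using I True even by (metis even_Suc less_irrefl Suc_lessI)
      then show ?thesis by blast
    next
      case False
      \<comment> \<open>For odd \<open>n\<close>, \<open>large\<close> is strict, so
        \<open>card S \<le> n - card X\<close> leaves a vertex of \<open>X\<close> outside
        \<open>S\<close>.\<close>
      have "n \<noteq> 2 * card X" using False by (metis dvd_triv_left)
      then have "card S < card X" using assms(2) large by linarith
      then obtain x where x: "x \<in> X" "x \<notin> S"
        using assms(1) by (metis less_irrefl subsetI subset_antisym)
      then have "x \<in> set xs" using sub ham by (auto simp: ham_path_def)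
      then obtain j where j: "j < n" "xs ! j = x" by (metis in_set_conv_nth length_ham)
      then have "even j" using alternating[of j] x True by simp
      then have "\<forall>i\<in>I. i \<noteq> j \<and> (i < j \<longrightarrow> even i = even j \<and> Suc i < n)"
        using I True j x by fastforce
      then show ?thesis by blast
    qed
  qed
  then obtain j where j: "\<And>i. i \<in> I \<Longrightarrow> i \<noteq> j \<and> (i < j \<longrightarrow> even i = even j \<and> Suc i < n)"
    by blast
  let ?f = "\<lambda>i. if i < j then Suc i else i - 1"
  have "card S = card I" using card_indices[of S] assms(1) sub by (simp add: I_def)
  also have "\<dots> = card (?f ` I)"
    by (rule card_image[symmetric], rule inj_on_step_away) (use j in blast)
  also have "\<dots> \<le> card {w. \<exists>s\<in>S. E s w}"
  proof (rule card_neighbours_ge)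
    show "?f ` I \<subseteq> {..<n}" using I(1) j by fastforce
    fix k assume "k \<in> ?f ` I"
    then obtain i where i: "i \<in> I" "k = ?f i" by blast
    have "E (xs ! i) (xs ! k)"
    proof (cases "i < j")
      case True
      then show ?thesis using i j path_step by simp
    next
      case False
      then obtain i' where "i = Suc i'" "k = i'" using i j[OF i(1)]
        by (cases i) auto
      then show ?thesis using path_step[of i'] I(1)[OF i(1)] sym by simp
    qed
    then show "\<exists>s\<in>S. E s (xs ! k)" using I(2)[OF i(1)] by blast
  qed
  finally show ?thesis .
qed

text \<open>Every vertex of \<open>S\<close> has a predecessor on the path. The path ends outside
  \<open>X\<close>, so the last vertex of \<open>S\<close> also has a successor, which is the extra
  neighbour.\<close>

lemma hall_even_path:
  assumes "S \<subseteq> X" "S \<noteq> {}" "even n" "xs ! 0 \<in> X" "xs ! 0 \<notin> S"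
  shows "card S < card {w. \<exists>s\<in>S. E s w}"
proof -
  define I where "I = {i. i < n \<and> xs ! i \<in> S}"
  have I: "i < n" "xs ! i \<in> S" "even i" "i \<noteq> 0" if "i \<in> I" for i
    using that alternating[of i] assms by (auto simp: I_def)
  have cI: "card S = card I" using card_indices[of S] assms(1) sub by (simp add: I_def)
  have "finite S" using assms(1) finite_X finite_subset by blast
  then have ne: "I \<noteq> {}" using cI assms(2) by auto
  have fin: "finite I" by (simp add: I_def)
  define m where "m = Max I"
  have m: "m \<in> I" "\<And>i. i \<in> I \<Longrightarrow> i \<le> m" using fin ne by (auto simp: m_def)
  \<comment> \<open>\<open>m\<close> and \<open>n\<close> are both even, so \<open>m\<close> is not
    the last position.\<close>
  have m1: "Suc m < n" using I[OF m(1)] assms(3) by (metis Suc_lessI even_Suc)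
  have "inj_on (\<lambda>i. i - 1) I"
  proof (rule inj_onI)
    fix a b assume "a \<in> I" "b \<in> I" "a - 1 = b - 1"
    then show "a = b" using I(4)[of a] I(4)[of b] by linarith
  qed
  then have "card S = card ((\<lambda>i. i - 1) ` I)" by (simp add: cI card_image)
  also have "\<dots> < card (insert (Suc m) ((\<lambda>i. i - 1) ` I))"
  proof -
    have "Suc m \<notin> (\<lambda>i. i - 1) ` I" using m(2) by fastforce
    then show ?thesis using fin by simp
  qed
  also have "\<dots> \<le> card {w. \<exists>s\<in>S. E s w}"
  proof (rule card_neighbours_ge)
    show "insert (Suc m) ((\<lambda>i. i - 1) ` I) \<subseteq> {..<n}" using I(1) m1 by fastforce
    fix k assume "k \<in> insert (Suc m) ((\<lambda>i. i - 1) ` I)"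
    then show "\<exists>s\<in>S. E s (xs ! k)"
    proof
      assume "k = Suc m"
      then show ?thesis using path_step[OF m1] I(2)[OF m(1)] by blast
    next
      assume "k \<in> (\<lambda>i. i - 1) ` I"
      then obtain i where i: "i \<in> I" "k = i - 1" by blast
      then have "i = Suc k" using I(4) by fastforce
      then show ?thesis using path_step[of k] I[OF i(1)] sym by metis
    qed
  qed
  finally show ?thesis .
qed

end

lemma ham_path_rotate:
  assumes "ham_cycle xs"
  shows "ham_path (rotate k xs)"
proof -
  have ham: "ham_path xs" using assms by (simp add: ham_cycle_def)
  note len = length_ham[OF ham]
  have cyc: "E (xs ! (i mod n)) (xs ! (Suc i mod n))" for i
  proof (cases "Suc (i mod n) < n")
    case True
    then show ?thesis using path_step[OF ham True] by (simp add: mod_Suc)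
  next
    \<comment> \<open>Here the successor wraps around to position 0, and the closing edge is
      used.\<close>
    case False
    have "0 < n" using assms by (simp add: ham_cycle_def)
    then have "Suc (i mod n) = n" using False mod_less_divisor[of n i] by linarith
    moreover from this have "i mod n = n - 1" by simp
    ultimately show ?thesis using assms by (simp add: mod_Suc ham_cycle_def)
  qed
  show ?thesis
    using ham cyc len by (auto simp: ham_path_def nth_rotate)
qed

lemma ham_cycle_even:
  assumes "ham_cycle xs"
  shows "even n"
proof -
  have ham: "ham_path xs" using assms by (simp add: ham_cycle_def)
  have "0 < n" using assms by (simp add: ham_cycle_def)
  then show ?thesis
    using cross[of "xs ! (n - 1)" "xs ! 0"] alternating[OF ham, of "n - 1"] assms
    by (auto simp: ham_cycle_def)
qed

text \<open>Cutting the cycle open at a vertex of \<open>X - S\<close> reduces this to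
  \<open>hall_even_path\<close>.\<close>

lemma hall_cycle:
  assumes "ham_cycle xs" "S \<subset> X" "S \<noteq> {}"
  shows "card S < card {w. \<exists>s\<in>S. E s w}"
proof -
  have ham: "ham_path xs" using assms by (simp add: ham_cycle_def)
  from assms(2) obtain x where x: "x \<in> X" "x \<notin> S" by blast
  then have "x \<in> set xs" using sub ham by (auto simp: ham_path_def)
  then obtain j where j: "j < n" "xs ! j = x" by (metis in_set_conv_nth length_ham[OF ham])
  then have "rotate j xs ! 0 = x" using nth_rotate[of 0 xs j] length_ham[OF ham] by simp
  then show ?thesis
    using hall_even_path[OF ham_path_rotate[OF assms(1), of j], of S] ham_cycle_even[OF assms(1)]
      x assms by auto
qed

text \<open>The flag \<open>c\<close> distinguishes cycles, on which \<open>X\<close> occupies the odd positions, from paths, on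
  which it occupies the even ones.\<close>

definition pos :: "bool \<Rightarrow> nat \<Rightarrow> nat" where
  "pos c v = 2 * rank v + (if v \<in> X \<longleftrightarrow> c then 1 else 0)"

text \<open>The parity of \<open>pos c v\<close> determines the class of \<open>v\<close>, and then
  \<open>rank_inj\<close> applies.\<close>

lemma pos_inj: "u < n \<Longrightarrow> v < n \<Longrightarrow> pos c u = pos c v \<Longrightarrow> u = v"
proof -
  assume *: "u < n" "v < n" "pos c u = pos c v"
  then have "u \<in> X \<longleftrightarrow> v \<in> X" unfolding pos_def by (auto split: if_splits) presburger+
  then show ?thesis using * rank_inj[of u v] by (simp add: pos_def)
qed

text \<open>Even positions are bounded through \<open>card_X_path\<close>, odd ones through
  \<open>large\<close>.\<close>

lemma pos_path_less:
  assumes "ham_path xs" "v < n"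
  shows "pos False v < n"
proof (cases "v \<in> X")
  case True
  then show ?thesis using rank_less_in[OF True] card_X_path[OF assms(1)] by (simp add: pos_def)
next
  case False
  then show ?thesis using rank_less_out[OF assms(2) False] large by (simp add: pos_def)
qed

text \<open>Of two consecutive vertices, the one in \<open>X\<close> has at least the rank of the
  other, \<open>y\<close>. Applying \<open>hall_path\<close> to \<open>Suc (rank y)\<close> low
  vertices gives the degree needed.\<close>

lemma pos_path_adjacent:
  assumes ham: "ham_path xs" and "u < n" "v < n" "pos False v = Suc (pos False u)"
  shows "E u v"
proof -
  have *: "E x y" if xy: "x \<in> X" "y < n" "y \<notin> X" "rank y \<le> rank x" for x y
  proof (rule adjacent_if_rank_less_deg)
    obtain S where S: "S \<subseteq> X" "card S = Suc (rank y)" "card {w. \<exists>s\<in>S. E s w} \<le> deg x"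
      using low_vertices[of x "Suc (rank y)"] xy by auto
    have "card S \<le> n - card X" using rank_less_out[OF xy(2,3)] S by simp
    from hall_path[OF ham S(1) this] show "rank y < deg x" using S by simp
  qed (use xy in auto)
  show ?thesis
  proof (cases "u \<in> X")
    case True
    then have "v \<notin> X" "rank v = rank u"
      using assms(4) by (auto simp: pos_def split: if_splits) presburger+
    then show ?thesis using * True assms by simp
  next
    case False
    then have "v \<in> X" "rank v = Suc (rank u)"
      using assms(4) by (auto simp: pos_def split: if_splits) presburger+
    then show ?thesis using *[of v u] False assms sym by simp
  qed
qed

lemma card_X_cycle: "ham_cycle xs \<Longrightarrow> 2 * card X = n"
  using card_X_path[of xs] ham_cycle_even[of xs] large
  unfolding ham_cycle_def by presburger

lemma pos_cycle_less:
  assumes "ham_cycle xs" "v < n"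
  shows "pos True v < n"
proof (cases "v \<in> X")
  case True
  then show ?thesis using rank_less_in[OF True] card_X_cycle[OF assms(1)] by (simp add: pos_def)
next
  case False
  then show ?thesis using rank_less_out[OF assms(2) False] large by (simp add: pos_def)
qed

text \<open>In the cyclic list, a vertex of \<open>X\<close> of rank \<open>r\<close> stands between
  vertices of ranks \<open>r\<close> and \<open>r + 1\<close>, or is last and joined to rank 0. The
  strict bound of \<open>hall_cycle\<close> makes \<open>rank y\<close> low vertices
  suffice.\<close>

lemma cycle_adjacent:
  assumes ham: "ham_cycle xs" and xy: "x \<in> X" "y < n" "y \<notin> X"
    and "rank y \<le> Suc (rank x)"
  shows "E x y"
proof (rule adjacent_if_rank_less_deg)
  \<comment> \<open>\<open>hall_cycle\<close> needs a nonempty set, so rank 0 is handled with one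
    vertex; this is still a proper subset, since \<open>card X \<ge> 2\<close>.\<close>
  let ?k = "if rank y = 0 then 1 else rank y"
  have k: "?k \<le> Suc (rank x)" using assms(5) by simp
  obtain S where S: "S \<subseteq> X" "card S = ?k" "card {w. \<exists>s\<in>S. E s w} \<le> deg x"
    using low_vertices[OF xy(1) k] by blast
  have c: "2 * card X = n" "3 \<le> n" using card_X_cycle[OF ham] ham by (auto simp: ham_cycle_def)
  have "rank y < n - card X" using rank_less_out xy by simp
  then have "card S < card X" using S c by auto
  then have "S \<subset> X" using S(1) by auto
  moreover have "S \<noteq> {}" using S(2) by (auto split: if_splits)
  ultimately have "card S < deg x" using hall_cycle[OF ham] S(3) by (meson order_less_le_trans)
  then show "rank y < deg x" using S(2) by (auto split: if_splits)
qed (use xy in auto)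

lemma pos_cycle_adjacent:
  assumes ham: "ham_cycle xs" and "u < n" "v < n" "pos True v = Suc (pos True u)"
  shows "E u v"
proof (cases "u \<in> X")
  case True
  then have "v \<notin> X" "rank v = Suc (rank u)"
    using assms(4) by (auto simp: pos_def split: if_splits) presburger+
  then show ?thesis using cycle_adjacent[OF ham] True assms by simp
next
  case False
  then have "v \<in> X" "rank v = rank u"
    using assms(4) by (auto simp: pos_def split: if_splits) presburger+
  then show ?thesis using cycle_adjacent[OF ham, of v u] False assms sym by simp
qed

lemma pos_cycle_closes:
  assumes ham: "ham_cycle xs" and "u < n" "v < n" "pos True u = n - 1" "pos True v = 0"
  shows "E u v"
proof -
  have "even n" "3 \<le> n" using ham_cycle_even[OF ham] ham by (auto simp: ham_cycle_def)
  then have "odd (pos True u)" using assms(4) by simp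
  then have "u \<in> X" by (auto simp: pos_def split: if_splits)
  moreover have "v \<notin> X" "rank v = 0" using assms(5) by (auto simp: pos_def split: if_splits)
  ultimately show ?thesis using cycle_adjacent[OF ham] assms by simp
qed

section \<open>The candidate list and its validity\<close>

definition vertex_at :: "bool \<Rightarrow> nat \<Rightarrow> nat" where
  "vertex_at c i = (\<Sum>w | w < n \<and> pos c w = i. w)"

lemma vertex_at_pos: "v < n \<Longrightarrow> vertex_at c (pos c v) = v"
proof -
  assume "v < n"
  then have "{w. w < n \<and> pos c w = pos c v} = {v}" using pos_inj by auto
  then show ?thesis by (simp add: vertex_at_def)
qed

text \<open>At an unoccupied position the empty sum yields 0, again a vertex, so the adjacency
  lookups stay inside the matrix even when the list is not a permutation.\<close>

lemma vertex_at_less: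
  assumes "0 < n"
  shows "vertex_at c i < n"
proof (cases "\<exists>w<n. pos c w = i")
  case True
  then show ?thesis using vertex_at_pos by auto
next
  case False
  then have "{w. w < n \<and> pos c w = i} = {}" by auto
  then have "vertex_at c i = 0" by (simp only: vertex_at_def sum.empty)
  then show ?thesis using assms by simp
qed

definition ham :: "bool \<Rightarrow> nat list \<Rightarrow> bool" where
  "ham c xs \<longleftrightarrow> (if c then ham_cycle xs else ham_path xs)"

definition valid :: "bool \<Rightarrow> bool" where
  "valid c \<longleftrightarrow>
     (\<forall>w<n. pos c w < n \<and> (Suc w < n \<longrightarrow> E (vertex_at c w) (vertex_at c (Suc w)))) \<and>
     (c \<longrightarrow> 3 \<le> n \<and> E (vertex_at c (n - 1)) (vertex_at c 0))"

text \<open>Each \<open>v\<close> occurs at index \<open>pos c v\<close>, so the \<open>n\<close>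
  entries cover all \<open>n\<close> vertices and are therefore distinct.\<close>

lemma valid_sound:
  assumes "valid c"
  shows "ham c (map (vertex_at c) [0..<n])"
proof -
  let ?xs = "map (vertex_at c) [0..<n]"
  have "set ?xs = {..<n}"
  proof
    show "set ?xs \<subseteq> {..<n}" using vertex_at_less by fastforce
    show "{..<n} \<subseteq> set ?xs"
    proof
      fix v assume "v \<in> {..<n}"
      then have "pos c v < n" "vertex_at c (pos c v) = v"
        using assms vertex_at_pos by (auto simp: valid_def)
      then show "v \<in> set ?xs" by (metis atLeast0LessThan image_eqI lessThan_iff list.set_map set_upt)
    qed
  qed
  moreover from this have "distinct ?xs" by (simp add: card_distinct)
  ultimately have "ham_path ?xs" using assms by (simp add: ham_path_def valid_def)
  then show ?thesis using assms by (auto simp: ham_def ham_cycle_def valid_def)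
qed

text \<open>Any solution bounds the injective map \<open>pos c\<close> by \<open>n\<close>, making
  it a permutation with inverse \<open>vertex_at c\<close>; the adjacency lemmas for positions then
  apply to the list.\<close>

lemma valid_complete:
  assumes "ham c xs"
  shows "valid c"
proof -
  have less: "pos c v < n" if "v < n" for v
    using assms that pos_path_less[of xs v] pos_cycle_less[of xs v] by (cases c) (auto simp: ham_def)
  have "inj_on (pos c) {..<n}" using pos_inj by (auto simp: inj_on_def)
  then have surj: "pos c ` {..<n} = {..<n}"
    using less by (intro endo_inj_surj) auto
  have at: "vertex_at c i < n \<and> pos c (vertex_at c i) = i" if "i < n" for i
  proof -
    have "i \<in> pos c ` {..<n}" using surj that by simp
    then obtain v where "v < n" "pos c v = i" by auto
    then show ?thesis using vertex_at_pos by auto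
  qed
  have "E (vertex_at c i) (vertex_at c (Suc i))" if "Suc i < n" for i
  proof (cases c)
    case True
    then have "ham_cycle xs" using assms by (simp add: ham_def)
    from pos_cycle_adjacent[OF this] show ?thesis using at[of i] at[of "Suc i"] that True by simp
  next
    case False
    then have "ham_path xs" using assms by (simp add: ham_def)
    from pos_path_adjacent[OF this] show ?thesis using at[of i] at[of "Suc i"] that False by simp
  qed
  moreover have "3 \<le> n \<and> E (vertex_at c (n - 1)) (vertex_at c 0)" if c
  proof -
    have "ham_cycle xs" "3 \<le> n" using assms that by (auto simp: ham_def ham_cycle_def)
    then show ?thesis
      using pos_cycle_closes[of xs "vertex_at c (n - 1)" "vertex_at c 0"] at[of "n - 1"] at[of 0] that
      by simp
  qed
  ultimately show ?thesis using less by (simp add: valid_def)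
qed

end

section \<open>Connected bipartite graphs without induced paths on five vertices\<close>

lemma path_edges_simps [simp]:
  "path_edges [x] = {}"
  "path_edges (x # y # xs) = insert {x, y} (path_edges (y # xs))"
proof -
  show "path_edges [x] = {}" by (simp add: path_edges_def)
  show "path_edges (x # y # xs) = insert {x, y} (path_edges (y # xs))"
  proof (intro set_eqI iffI)
    fix e assume "e \<in> path_edges (x # y # xs)"
    then obtain i where i: "e = {(x # y # xs) ! i, (x # y # xs) ! Suc i}" "Suc i < length (x # y # xs)"
      by (auto simp: path_edges_def)
    then show "e \<in> insert {x, y} (path_edges (y # xs))"
      by (cases i) (auto simp: path_edges_def)
  next
    fix e assume "e \<in> insert {x, y} (path_edges (y # xs))"
    then show "e \<in> path_edges (x # y # xs)"
    proof
      assume "e \<in> path_edges (y # xs)"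
      then obtain i where "e = {(y # xs) ! i, (y # xs) ! Suc i}" "Suc i < length (y # xs)"
        by (auto simp: path_edges_def)
      then have "e = {(x # y # xs) ! Suc i, (x # y # xs) ! Suc (Suc i)} \<and>
          Suc (Suc i) < length (x # y # xs)" by simp
      then show ?thesis unfolding path_edges_def by blast
    qed (auto simp: path_edges_def intro!: exI[of _ 0])
  qed
qed

lemma path_edges_subset:
  "path_edges xs \<subseteq> F \<longleftrightarrow> (\<forall>i. Suc i < length xs \<longrightarrow> {xs ! i, xs ! Suc i} \<in> F)"
  by (auto simp: path_edges_def)

locale P5_free_bipartite =
  fixes G :: "nat ugraph" and n :: nat
  assumes simple: "simple_graph G" and verts: "vertices G = {..<n}"
    and conn: "connected_graph G" and bip: "bipartite G" and P5: "P5_free G"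
begin

text \<open>An arbitrary colour class, for use in proofs only; the program computes
  \<open>core\<close> instead.\<close>

definition side :: "nat set" where
  "side = (SOME A. \<exists>B. A \<union> B = vertices G \<and> A \<inter> B = {} \<and>
     (\<forall>e\<in>edges G. \<exists>a\<in>A. \<exists>b\<in>B. e = {a, b}))"

lemma edge_sides:
  assumes "{u, v} \<in> edges G"
  shows "u \<in> side \<longleftrightarrow> v \<notin> side"
proof -
  have "\<exists>B. side \<union> B = vertices G \<and> side \<inter> B = {} \<and>
     (\<forall>e\<in>edges G. \<exists>a\<in>side. \<exists>b\<in>B. e = {a, b})"
    using bip unfolding bipartite_def side_def by (rule someI_ex)
  then obtain B where "side \<inter> B = {}" "\<forall>e\<in>edges G. \<exists>a\<in>side. \<exists>b\<in>B. e = {a, b}" by blast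
  then obtain a b where "a \<in> side" "b \<in> B" "{u, v} = {a, b}" using assms by blast
  then show ?thesis using \<open>side \<inter> B = {}\<close> by (auto simp: doubleton_eq_iff)
qed

lemma edge_less: "{u, v} \<in> edges G \<Longrightarrow> u < n \<and> v < n"
  using simple verts by (auto simp: simple_graph_def)

lemma n_positive: "0 < n"
  using conn verts by (auto simp: connected_graph_def)

lemma path_between: "u < n \<Longrightarrow> v < n \<Longrightarrow> \<exists>xs. is_path G xs \<and> hd xs = u \<and> last xs = v"
  using conn verts by (simp add: connected_graph_def)

text \<open>The only nonconsecutive pairs joining different classes are \<open>p, v\<close> and
  \<open>u, q\<close>, so excluding these two edges makes the path induced. Their absence also
  separates the vertices within each class.\<close>

lemma no_P5:
  assumes e: "{p, u} \<in> edges G" "{u, b} \<in> edges G" "{b, v} \<in> edges G" "{v, q} \<in> edges G"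
    and ne: "{p, v} \<notin> edges G" "{u, q} \<notin> edges G"
  shows False
proof -
  let ?xs = "[p, u, b, v, q]"
  have sides: "p \<in> side \<longleftrightarrow> u \<notin> side" "b \<in> side \<longleftrightarrow> u \<notin> side" "v \<in> side \<longleftrightarrow> u \<in> side"
    "q \<in> side \<longleftrightarrow> u \<notin> side"
    using e edge_sides by blast+
  have "distinct ?xs"
  proof -
    have "p \<noteq> b" "p \<noteq> q" "b \<noteq> q" "u \<noteq> v" using e ne by (auto simp: insert_commute)
    then show ?thesis using sides by auto
  qed
  moreover have "set ?xs \<subseteq> vertices G" using e edge_less verts by auto
  ultimately have path: "is_path G ?xs" using e by (simp add: is_path_def)
  have "e' \<in> path_edges ?xs" if e': "e' \<in> edges G" "e' \<subseteq> set ?xs" for e'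
  proof -
    obtain x y where xy: "e' = {x, y}"
      using simple e'(1) by (auto simp: simple_graph_def card_2_iff)
    have same: "x \<in> side \<longleftrightarrow> y \<notin> side" using edge_sides e'(1) xy by blast
    have "x \<in> {p, u, b, v, q}" "y \<in> {p, u, b, v, q}" using e'(2) xy by auto
    moreover have "{v, p} \<notin> edges G" "{q, u} \<notin> edges G" using ne by (simp_all add: insert_commute)
    ultimately show ?thesis using same sides e'(1) ne unfolding xy
      by (elim insertE emptyE) (simp_all add: insert_commute)
  qed
  then have "is_induced_path G ?xs" using path by (auto simp: is_induced_path_def is_path_def)
  then show False using P5 by (auto simp: P5_free_def)
qed

lemma edge_commute: "{u, v} \<in> edges G \<Longrightarrow> {v, u} \<in> edges G"
  by (simp add: insert_commute)

text \<open>Induction along a path from \<open>a\<close> to \<open>v\<close>, two steps at a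
  time.\<close>

lemma common_neighbour:
  assumes "{a, w} \<in> edges G" "v < n" "v \<in> side \<longleftrightarrow> a \<in> side"
  shows "\<exists>w. {a, w} \<in> edges G \<and> {v, w} \<in> edges G"
proof -
  have "a < n" using edge_less assms(1) by blast
  then obtain xs where xs: "is_path G xs" "hd xs = a" "last xs = v"
    using path_between assms(2) by blast
  then have ne: "xs \<noteq> []" by (simp add: is_path_def)
  have step: "{xs ! i, xs ! Suc i} \<in> edges G" if "Suc i < length xs" for i
    using xs(1) that path_edges_subset[of xs "edges G"] by (simp add: is_path_def)
  have "\<exists>w. {a, w} \<in> edges G \<and> {xs ! i, w} \<in> edges G"
    if "i < length xs" "xs ! i \<in> side \<longleftrightarrow> a \<in> side" for i
    using that
  proof (induction i rule: less_induct)
    case (less i)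
    consider "i = 0" | "i = 1" | j where "i = Suc (Suc j)"
      by (metis One_nat_def not0_implies_Suc)
    then show ?case
    proof cases
      case 1
      then show ?thesis using xs ne assms(1) by (auto simp: hd_conv_nth)
    next
      case 2
      then have "{a, xs ! i} \<in> edges G" using step[of 0] less.prems xs ne by (simp add: hd_conv_nth)
      then show ?thesis using edge_sides less.prems by blast
    next
      case 3
      let ?x = "xs ! j" and ?m = "xs ! Suc j" and ?y = "xs ! i"
      have e: "{?x, ?m} \<in> edges G" "{?m, ?y} \<in> edges G"
        using step[of j] step[of "Suc j"] 3 less.prems by simp_all
      then have "?x \<in> side \<longleftrightarrow> a \<in> side" using edge_sides less.prems by blast
      then obtain w where w: "{a, w} \<in> edges G" "{?x, w} \<in> edges G"
        using less.IH[of j] 3 less.prems by auto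
      show ?thesis
      proof (rule ccontr)
        assume *: "\<not> ?thesis"
        show False
        \<comment> \<open>An edge from \<open>a\<close> to \<open>?m\<close> or from
          \<open>w\<close> to \<open>?y\<close> would give a common neighbour of \<open>a\<close>
          and \<open>?y\<close>; without both, \<open>a, w, ?x, ?m, ?y\<close> is an induced
          path.\<close>
        proof (rule no_P5)
          show "{a, w} \<in> edges G" "{w, ?x} \<in> edges G" "{?x, ?m} \<in> edges G" "{?m, ?y} \<in> edges G"
            using w e edge_commute by auto
          show "{a, ?m} \<notin> edges G" "{w, ?y} \<notin> edges G" using * w e edge_commute by blast+
        qed
      qed
    qed
  qed
  from this[of "length xs - 1"] show ?thesis using ne xs assms(3) by (simp add: last_conv_nth)
qed

lemma neighbourhoods_nested:
  assumes "u < n" "v < n" "u \<in> side \<longleftrightarrow> v \<in> side"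
  shows "(\<forall>w. {u, w} \<in> edges G \<longrightarrow> {v, w} \<in> edges G) \<or> (\<forall>w. {v, w} \<in> edges G \<longrightarrow> {u, w} \<in> edges G)"
proof (rule ccontr)
  assume "\<not> ?thesis"
  then obtain p q where pq: "{u, p} \<in> edges G" "{v, p} \<notin> edges G" "{v, q} \<in> edges G" "{u, q} \<notin> edges G"
    by blast
  then obtain w where "{u, w} \<in> edges G" "{v, w} \<in> edges G" using common_neighbour assms by metis
  then show False using no_P5[of p u w v q] pq edge_commute by blast
qed

text \<open>The colour class of vertex 0, except that it is empty when \<open>n = 1\<close>.\<close>

definition core :: "nat set" where
  "core = {v. v < n \<and> (\<exists>w. {v, w} \<in> edges G \<and> {0, w} \<in> edges G)}"

lemma core_iff:
  assumes "2 \<le> n" "v < n"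
  shows "v \<in> core \<longleftrightarrow> (v \<in> side \<longleftrightarrow> 0 \<in> side)"
proof -
  \<comment> \<open>The second vertex of a path from 0 to 1 provides a neighbour of 0.\<close>
  obtain xs where xs: "is_path G xs" "hd xs = 0" "last xs = 1"
    using path_between[of 0 1] assms by auto
  obtain w where w: "{0, w} \<in> edges G"
  proof (cases xs)
    case Nil
    then show ?thesis using xs by (simp add: is_path_def)
  next
    case (Cons x ys)
    then obtain y zs where "ys = y # zs" using xs by (cases ys) auto
    then show ?thesis using that[of y] xs Cons by (simp add: is_path_def)
  qed
  show ?thesis
  proof
    assume "v \<in> core"
    then show "v \<in> side \<longleftrightarrow> 0 \<in> side" using edge_sides by (auto simp: core_def)
  next
    assume "v \<in> side \<longleftrightarrow> 0 \<in> side"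
    then show "v \<in> core" using common_neighbour[OF w, of v] assms by (auto simp: core_def)
  qed
qed

text \<open>For \<open>n = 1\<close> the core is empty and its complement \<open>{0}\<close> is
  taken.\<close>

definition major :: "nat set" where
  "major = (if n \<le> 2 * card core then core else {..<n} - core)"

lemma major_iff:
  assumes "u < n" "v < n" "u \<noteq> v"
  shows "(u \<in> major \<longleftrightarrow> v \<in> major) \<longleftrightarrow> (u \<in> side \<longleftrightarrow> v \<in> side)"
proof -
  have "2 \<le> n" using assms by linarith
  then show ?thesis using core_iff assms by (auto simp: major_def)
qed

sublocale bipartite_chain n "\<lambda>u v. {u, v} \<in> edges G" major
proof
  show "{u, v} \<in> edges G \<Longrightarrow> {v, u} \<in> edges G" for u v by (rule edge_commute)
  show "{u, v} \<in> edges G \<Longrightarrow> u < n" for u v using edge_less by blast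
  show "major \<subseteq> {..<n}" by (auto simp: major_def core_def)
  show "u \<in> major \<longleftrightarrow> v \<notin> major" if "{u, v} \<in> edges G" for u v
    using major_iff[of u v] edge_sides[OF that] edge_less[OF that] by blast
  show "(\<forall>w. {u, w} \<in> edges G \<longrightarrow> {v, w} \<in> edges G) \<or> (\<forall>w. {v, w} \<in> edges G \<longrightarrow> {u, w} \<in> edges G)"
    if "u < n" "v < n" "u \<in> major \<longleftrightarrow> v \<in> major" for u v
    using neighbourhoods_nested[of u v] major_iff[of u v] that by (cases "u = v") simp_all
  have "core \<subseteq> {..<n}" by (auto simp: core_def)
  then have "card ({..<n} - core) = n - card core"
    by (simp add: card_Diff_subset finite_subset)
  then show "n \<le> 2 * card major" by (auto simp: major_def)
qed

lemma hamiltonian_path_iff: "hamiltonian_path G xs \<longleftrightarrow> ham False xs"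
proof -
  have "xs \<noteq> []" if "set xs = {..<n}"
    using that n_positive by (metis empty_iff empty_set lessThan_iff)
  then show ?thesis
    by (auto simp: hamiltonian_path_def ham_def ham_path_def is_path_def verts path_edges_subset)
qed

lemma hamiltonian_cycle_iff: "hamiltonian_cycle G xs \<longleftrightarrow> ham True xs"
proof (cases "distinct xs \<and> set xs = {..<n}")
  case True
  then have "length xs = n" "xs \<noteq> []" using distinct_card[of xs] n_positive by auto
  then show ?thesis using True
    by (auto simp: hamiltonian_cycle_def ham_def ham_cycle_def ham_path_def is_cycle_def verts
        path_edges_subset cycle_edges_def hd_conv_nth last_conv_nth)
next
  case False
  then show ?thesis
    by (auto simp: hamiltonian_cycle_def ham_def ham_cycle_def ham_path_def is_cycle_def verts)
qed

end

section \<open>The algorithm\<close>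

abbreviation Disj :: "bexp \<Rightarrow> bexp \<Rightarrow> bexp" where
  "Disj a b \<equiv> Negate (Conj (Negate a) (Negate b))"

abbreviation Iff :: "bexp \<Rightarrow> bexp \<Rightarrow> bexp" where
  "Iff a b \<equiv> Disj (Conj a b) (Conj (Negate a) (Negate b))"

text \<open>The machine cannot multiply, so the offset \<open>v * n\<close> of a matrix row is read
  from the array \<open>row\<close>.\<close>

abbreviation Adjacent :: "aexp \<Rightarrow> aexp \<Rightarrow> bexp" where
  "Adjacent e f \<equiv> Equal (Read ''adj'' (Add (Read ''row'' e) f)) (Const 1)"

text \<open>Membership of \<open>w\<close> in \<open>below v\<close>.\<close>

definition rank_test :: bexp where
  "rank_test = (let v = Var ''v''; w = Var ''w'' in
     Conj (Equal (Read ''first'' v) (Read ''first'' w))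
       (Disj (Disj (Conj (Equal (Read ''first'' v) (Const 1)) (Less (Read ''deg'' w) (Read ''deg'' v)))
            (Conj (Equal (Read ''first'' v) (Const 0)) (Less (Read ''deg'' v) (Read ''deg'' w))))
         (Conj (Equal (Read ''deg'' w) (Read ''deg'' v)) (Less w v))))"

definition defect_test :: "bool \<Rightarrow> bexp" where
  "defect_test c = (let w = Var ''w''; n = Var ''n'' in
     Disj (Disj (Negate (Less (Read ''pos'' w) n))
         (Conj (Less (Add w (Const 1)) n)
           (Negate (Adjacent (Read ''out'' w) (Read ''out'' (Add w (Const 1)))))))
       (if c then Disj (Less n (Const 3))
           (Negate (Adjacent (Read ''out'' (Sub n (Const 1))) (Read ''out'' (Const 0))))
        else Less n n))"

text \<open>The conditions \<open>w = 0\<close> make the sum over \<open>w\<close> a plain assignment. \<open>com\<close> counts common neighbours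
  with vertex 0; \<open>first\<close> marks the larger colour class; the stage \<open>out\<close> inverts the permutation
  \<open>pos\<close>, a sum with at most one summand; \<open>bad\<close> counts, in every cell, the defects of the list
  \<open>out\<close>.\<close>

definition stages :: "bool \<Rightarrow> stage list" where
  "stages c = (let v = Var ''v''; w = Var ''w''; n = Var ''n''; zero = Const 0; one = Const 1;
      once = Conj (Equal v zero) (Equal w zero) in
    [(''row'', Less w v, n),
     (''deg'', Adjacent v w, one),
     (''com'', Conj (Adjacent v w) (Equal (Read ''adj'' w) one), one),
     (''cnt'', Less zero (Read ''com'' w), one),
     (''first'', Conj (Equal w zero) (Iff (Less zero (Read ''com'' v))
        (Negate (Less (Add (Var ''cnt'') (Var ''cnt'')) n))), one),
     (''rank'', rank_test, one),
     (''pos'', Equal w zero, Add (Add (Read ''rank'' v) (Read ''rank'' v))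
        (if c then Read ''first'' v else Sub one (Read ''first'' v))),
     (''out'', Equal (Read ''pos'' w) v, w),
     (''bad'', defect_test c, one),
     (''answer'', Conj once (Equal (Var ''bad'') zero), one),
     (''out_length'', once, n)])"

lemma well_staged_stages: "well_staged {''n'', ''adj''} (stages c)"
  by (simp add: stages_def rank_test_def defect_test_def Let_def)

section \<open>Correctness and running time of the stages\<close>

context P5_free_bipartite
begin

lemma row_adj:
  assumes "v < n" "w < n"
  shows "graph_input G ''adj'' (v * n + w) = (if {v, w} \<in> edges G then 1 else 0)"
proof -
  have "v * n + w < n * n"
  proof -
    have "v * n + w < Suc v * n" using assms by simp
    also have "\<dots> \<le> n * n" using assms by (intro mult_le_mono) auto
    finally show ?thesis .
  qed
  moreover have "(v * n + w) div n = v" "(v * n + w) mod n = w" using assms by auto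
  ultimately show ?thesis by (simp add: graph_input_def Let_def verts)
qed

lemma stages_correct:
  assumes adj: "s ''adj'' = graph_input G ''adj''" and n: "s ''n'' 0 = n"
    and st: "\<forall>(y, b, e)\<in>set (stages c). \<forall>v<n. s y v = tally b e s v n"
  shows "s ''answer'' 0 = (if valid c then 1 else 0)"
    and "list_output s = map (vertex_at c) [0..<n]"
proof -
  note eqs = st[unfolded stages_def Let_def, simplified]
  note row_eq = eqs[THEN conjunct1, rule_format] and rest0 = eqs[THEN conjunct2]
  note deg_eq = rest0[THEN conjunct1, rule_format] and rest1 = rest0[THEN conjunct2]
  note com_eq = rest1[THEN conjunct1, rule_format] and rest2 = rest1[THEN conjunct2]
  note cnt_eq = rest2[THEN conjunct1, rule_format] and rest3 = rest2[THEN conjunct2]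
  note first_eq = rest3[THEN conjunct1, rule_format] and rest4 = rest3[THEN conjunct2]
  note rank_eq = rest4[THEN conjunct1, rule_format] and rest5 = rest4[THEN conjunct2]
  note pos_eq = rest5[THEN conjunct1, rule_format] and rest6 = rest5[THEN conjunct2]
  note out_eq = rest6[THEN conjunct1, rule_format] and rest7 = rest6[THEN conjunct2]
  note bad_eq = rest7[THEN conjunct1, rule_format] and rest8 = rest7[THEN conjunct2]
  note answer_eq = rest8[THEN conjunct1, rule_format] and rest9 = rest8[THEN conjunct2]
  note out_length_eq = rest9[rule_format]
  have row: "s ''row'' v = v * n" if "v < n" for v
  proof -
    have "{k. k < n \<and> k < v} = {..<v}" using that by auto
    then show ?thesis using row_eq that n by (simp add: tally_def)
  qed
  have A: "s ''adj'' (s ''row'' v + w) = Suc 0 \<longleftrightarrow> {v, w} \<in> edges G" if "v < n" "w < n" for v w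
    using row that adj row_adj by simp
  \<comment> \<open>Row 0 has offset 0, so adjacency to vertex 0 is read without
    \<open>row\<close>.\<close>
  have A0: "s ''adj'' w = Suc 0 \<longleftrightarrow> {0, w} \<in> edges G" if "w < n" for w
    using A[of 0 w] row[of 0] n_positive that by simp
  have deg: "s ''deg'' v = deg v" if "v < n" for v
  proof -
    have "{w. w < n \<and> s ''adj'' (s ''row'' v + w) = Suc 0} = {w. w < n \<and> {v, w} \<in> edges G}"
      using A that by blast
    then show ?thesis using deg_eq that by (simp add: tally_def deg_def)
  qed
  have com: "0 < s ''com'' v \<longleftrightarrow> v \<in> core" if "v < n" for v
  proof -
    have "{w. w < n \<and> s ''adj'' (s ''row'' v + w) = Suc 0 \<and> s ''adj'' w = Suc 0} =
        {w. w < n \<and> {v, w} \<in> edges G \<and> {0, w} \<in> edges G}"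
      using A A0 that by blast
    then have "s ''com'' v = card {w. w < n \<and> {v, w} \<in> edges G \<and> {0, w} \<in> edges G}"
      using com_eq that by (simp add: tally_def)
    then show ?thesis using that edge_less by (auto simp: card_gt_0_iff core_def)
  qed
  have cnt: "s ''cnt'' 0 = card core"
  proof -
    have "{w. w < n \<and> 0 < s ''com'' w} = core" using com by (auto simp: core_def)
    then show ?thesis using cnt_eq n_positive by (simp add: tally_def)
  qed
  have first: "s ''first'' v = (if v \<in> major then 1 else 0)" if "v < n" for v
  proof -
    have "v \<in> major \<longleftrightarrow> 0 < s ''com'' v \<and> n \<le> s ''cnt'' 0 + s ''cnt'' 0 \<or>
        s ''com'' v = 0 \<and> \<not> n \<le> s ''cnt'' 0 + s ''cnt'' 0"
      using com[OF that] cnt that by (auto simp: major_def)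
    moreover have "{w. w = 0 \<and> w < n \<and> P} = (if P then {0} else {})" for P
      using n_positive by auto
    ultimately show ?thesis using first_eq[OF that] n by (simp add: tally_def not_less)
  qed
  have rank: "s ''rank'' v = rank v" if "v < n" for v
  proof -
    have "bval rank_test (at_pair s v u) \<longleftrightarrow> (u \<in> major \<longleftrightarrow> v \<in> major) \<and> prec u v" if "u < n" for u
      using deg[OF \<open>v < n\<close>] deg[OF that] first[OF \<open>v < n\<close>] first[OF that]
      by (cases "u \<in> major"; cases "v \<in> major") (auto simp: rank_test_def prec_def Let_def)
    then have "{w. w < n \<and> bval rank_test (at_pair s v w)} =
        {u. u < n \<and> (u \<in> major \<longleftrightarrow> v \<in> major) \<and> prec u v}"
      by blast
    then show ?thesis using rank_eq that by (simp add: tally_def rank_def below_def)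
  qed
  have pos: "s ''pos'' v = pos c v" if "v < n" for v
  proof -
    have "{w. w < n \<and> w = 0} = {0}" using n_positive by auto
    then show ?thesis using pos_eq that rank first by (simp add: tally_def pos_def)
  qed
  have out: "s ''out'' i = vertex_at c i" if "i < n" for i
  proof -
    have "{w. w < n \<and> s ''pos'' w = i} = {w. w < n \<and> pos c w = i}" using pos by auto
    then show ?thesis using out_eq that by (simp add: tally_def vertex_at_def)
  qed
  note less = vertex_at_less[OF n_positive]
  have "s ''bad'' 0 = card {w. w < n \<and> bval (defect_test c) (at_pair s 0 w)}"
    using bad_eq n_positive by (simp add: tally_def)
  \<comment> \<open>Conditions not mentioning \<open>w\<close> are detected as well, because
    \<open>n\<close> is positive and some \<open>w\<close> is tested.\<close>
  moreover have "{w. w < n \<and> bval (defect_test c) (at_pair s 0 w)} = {} \<longleftrightarrow> valid c"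
    using pos out n_positive A less n by (auto simp: defect_test_def valid_def Let_def)
  ultimately have bad: "s ''bad'' 0 = 0 \<longleftrightarrow> valid c" by simp
  have once: "{w. w < n \<and> w = 0 \<and> P} = (if P then {0} else {})" "{w. w < n \<and> w = 0} = {0}" for P
    using n_positive by auto
  show "s ''answer'' 0 = (if valid c then 1 else 0)"
    using answer_eq n_positive bad once by (simp add: tally_def)
  have "s ''out_length'' 0 = n"
    using out_length_eq n_positive n once by (simp add: tally_def)
  then show "list_output s = map (vertex_at c) [0..<n]" using out by (simp add: list_output_def)
qed

lemma program_correct:
  "\<exists>t s. exec (program (stages c)) (graph_input G) t s \<and> t \<le> 110 * n ^ 2 + 110 \<and>
     (if \<exists>xs. ham c xs then s ''answer'' 0 = 1 \<and> ham c (list_output s) else s ''answer'' 0 = 0)"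
proof -
  have "graph_input G ''n'' 0 = n" by (simp add: graph_input_def verts)
  moreover have "graph_input G ''v'' = single 0" "graph_input G ''w'' = single 0"
    by (auto simp: graph_input_def Let_def fun_eq_iff)
  moreover have "graph_input G x = (\<lambda>_. 0)" if "x \<notin> {''n'', ''adj''}" for x
    using that by (auto simp: graph_input_def Let_def fun_eq_iff)
  ultimately obtain t s where t: "exec (program (stages c)) (graph_input G) t s"
      "t \<le> length (stages c) * (n * (n * 4 + 4) + 2) + 1"
    and s: "\<forall>x\<in>{''n'', ''adj''}. s x = graph_input G x"
      "\<forall>(y, b, e)\<in>set (stages c). \<forall>v<n. s y v = tally b e s v n"
    using exec_program[OF well_staged_stages, of "graph_input G" n 0 0 c] by auto
  have "s ''n'' 0 = n" using s(1) \<open>graph_input G ''n'' 0 = n\<close> by simp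
  note correct = stages_correct[OF _ this s(2)]
  \<comment> \<open>The eleven stages take at most \<open>44 * n ^ 2 + 44 * n + 23\<close> steps;
    the linear term is absorbed into the square.\<close>
  have "n \<le> n ^ 2" by (simp add: power2_eq_square)
  moreover have "length (stages c) = 11" by (simp add: stages_def Let_def)
  moreover from this t(2) have "t \<le> 44 * n ^ 2 + 44 * n + 23"
    by (simp add: power2_eq_square algebra_simps)
  ultimately have "t \<le> 110 * n ^ 2 + 110" by linarith
  then show ?thesis using t(1) correct s(1) valid_sound valid_complete
    by (intro exI[of _ t] exI[of _ s]) auto
qed

end

theorem theorem4:
  "poly_time_search (\<lambda>G. connected_graph G \<and> chordal_bipartite G \<and> P5_free G) hamiltonian_cycle \<and>
   poly_time_search (\<lambda>G. connected_graph G \<and> chordal_bipartite G \<and> P5_free G) hamiltonian_path"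
proof
  show "poly_time_search (\<lambda>G. connected_graph G \<and> chordal_bipartite G \<and> P5_free G) hamiltonian_cycle"
    unfolding poly_time_search_def
  proof (rule exI[of _ "program (stages True)"], rule exI[of _ 110], rule exI[of _ 2], intro allI impI)
    fix G :: "nat ugraph" and n
    assume "simple_graph G \<and> vertices G = {..<n} \<and>
      (connected_graph G \<and> chordal_bipartite G \<and> P5_free G)"
    then interpret P5_free_bipartite G n
      by unfold_locales (auto simp: chordal_bipartite_def)
    show "\<exists>t s. exec (program (stages True)) (graph_input G) t s \<and> t \<le> 110 * n ^ 2 + 110 \<and>
      (if \<exists>xs. hamiltonian_cycle G xs then s ''answer'' 0 = 1 \<and> hamiltonian_cycle G (list_output s)
       else s ''answer'' 0 = 0)"
      using program_correct[of True] unfolding hamiltonian_cycle_iff .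
  qed
  show "poly_time_search (\<lambda>G. connected_graph G \<and> chordal_bipartite G \<and> P5_free G) hamiltonian_path"
    unfolding poly_time_search_def
  proof (rule exI[of _ "program (stages False)"], rule exI[of _ 110], rule exI[of _ 2], intro allI impI)
    fix G :: "nat ugraph" and n
    assume "simple_graph G \<and> vertices G = {..<n} \<and>
      (connected_graph G \<and> chordal_bipartite G \<and> P5_free G)"
    then interpret P5_free_bipartite G n
      by unfold_locales (auto simp: chordal_bipartite_def)
    show "\<exists>t s. exec (program (stages False)) (graph_input G) t s \<and> t \<le> 110 * n ^ 2 + 110 \<and>
      (if \<exists>xs. hamiltonian_path G xs then s ''answer'' 0 = 1 \<and> hamiltonian_path G (list_output s)
       else s ''answer'' 0 = 0)"
      using program_correct[of False] unfolding hamiltonian_path_iff .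
  qed
qed

end
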